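(* Let $a_k=2^k+1$ for $k\ge1$, and $S_n(\omega)=\sum_{k=1}^n\cos(2\pi a_k\omega)$, $\omega\in[0,1]$, viewed as a random variable on $[0,1]$ with Lebesgue measure. Then $\kappa_m(S_n)=0$ for every odd $m\ge1$ and every $n\ge1$, and $$\kappa_2(S_n)=\frac n2\ \ (n\ge1),\qquad \kappa_4(S_n)=\frac{-3n+28}{8}\ \ (n\ge4),\qquad \kappa_6(S_n)=\frac{45n^2+380n-1875}{16}\ \ (n\ge7).$$
   Context: For a bounded random variable $X$, its $m$-th cumulant is $\kappa_m(X)=\frac{d^m}{dt^m}\log\mathbb E[e^{tX}]\big|_{t=0}$. *)

theory Defs
  imports "HOL-Analysis.Analysis"
begin

definition mgf :: "'a measure \<Rightarrow> ('a \<Rightarrow> real) \<Rightarrow> real \<Rightarrow> real" where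
  "mgf M X t = (\<integral>x. exp (t * X x) \<partial>M)"

definition cumulant :: "'a measure \<Rightarrow> ('a \<Rightarrow> real) \<Rightarrow> nat \<Rightarrow> real" where
  "cumulant M X m = (deriv ^^ m) (\<lambda>t. ln (mgf M X t)) 0"

definition a_seq :: "nat \<Rightarrow> nat" where
  "a_seq k = 2 ^ k + 1"

definition S :: "nat \<Rightarrow> real \<Rightarrow> real" where
  "S n \<omega> = (\<Sum>k=1..n. cos (2 * pi * real (a_seq k) * \<omega>))"

end

theory Submission
  imports Defs "HOL-Probability.Probability_Measure" "HOL-Computational_Algebra.Polynomial"
begin

(*
  Cumulants are determined by moments: comparing coefficients in F' = (F'/F) F, where F is the
  exponential moment series, gives E X^(m+1) = (SUM i<=m. (m choose i) kappa_(i+1) E X^(m-i)).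
  When the odd moments vanish, so do the odd cumulants, and kappa_2, kappa_4, kappa_6 are explicit
  polynomials in the second, fourth and sixth moments.

  For S_n, the product formula 2 cos u cos v = cos (u + v) + cos (u - v) turns 2^r E S_n^r into the
  number of choices of signs e_i and exponents k_i in {1..n} with SUM e_i (2^k_i + 1) = 0. Grouping by
  the number a of positive signs, this is SUM_a (r choose a) N_n(2a - r, a, r - a), where N_n(j, a, c)
  counts the solutions of j + 2^k_1 + ... + 2^k_a = 2^l_1 + ... + 2^l_c in exponents from {1..n}.
  Splitting off the exponents equal to 1 and halving the equation expresses N_(n+1) through N_n.
  The patterns (j, a, c) reached from those needed for r <= 6 form a finite set on which N_n is a
  polynomial in n from some n_0 on: the values at n_0 are obtained by running the recurrence, and
  the induction step is a polynomial identity; both are checked by evaluation.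
*)

section \<open>Cumulants of bounded random variables\<close>

text \<open>Real-variable versions of \<open>fps_nth_conv_deriv\<close> and \<open>fps_nth_fps_expansion\<close>, which the
  library states for complex functions.\<close>

lemma fps_nth_conv_deriv_real:
  fixes f :: "real fps"
  assumes "fps_conv_radius f > 0"
  shows "fps_nth f n = (deriv ^^ n) (eval_fps f) 0 / fact n"
  using assms
proof (induction n arbitrary: f)
  case 0
  then show ?case by (simp add: eval_fps_def)
next
  case (Suc n f)
  have "(deriv ^^ Suc n) (eval_fps f) 0 = (deriv ^^ n) (deriv (eval_fps f)) 0"
    unfolding funpow_Suc_right o_def ..
  also have "eventually (\<lambda>z::real. z \<in> eball 0 (fps_conv_radius f)) (nhds 0)"
    using Suc.prems by (intro eventually_nhds_in_open) (auto simp: zero_ereal_def)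
  then have "eventually (\<lambda>z. deriv (eval_fps f) z = eval_fps (fps_deriv f) z) (nhds 0)"
    by eventually_elim (simp add: eval_fps_deriv)
  then have "(deriv ^^ n) (deriv (eval_fps f)) 0 = (deriv ^^ n) (eval_fps (fps_deriv f)) 0"
    by (intro higher_deriv_cong_ev refl)
  also have "\<dots> / fact n = fps_nth (fps_deriv f) n"
    using Suc.prems fps_conv_radius_deriv[of f] by (intro Suc.IH [symmetric]) auto
  also have "\<dots> / of_nat (Suc n) = fps_nth f (Suc n)"
    by (simp add: fps_deriv_def del: of_nat_Suc)
  finally show ?case by (simp add: field_split_simps)
qed

lemma fps_nth_fps_expansion_real:
  fixes f :: "real \<Rightarrow> real"
  assumes "f has_fps_expansion F"
  shows "fps_nth F n = (deriv ^^ n) f 0 / fact n"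
proof -
  have "fps_nth F n = (deriv ^^ n) (eval_fps F) 0 / fact n"
    using assms by (intro fps_nth_conv_deriv_real) (auto simp: has_fps_expansion_def)
  also have "(deriv ^^ n) (eval_fps F) 0 = (deriv ^^ n) f 0"
    using assms by (intro higher_deriv_cong_ev) (auto simp: has_fps_expansion_def)
  finally show ?thesis .
qed

locale bounded_random_variable = prob_space M for M :: "'a measure" +
  fixes X :: "'a \<Rightarrow> real" and B :: real
  assumes random_variable: "X \<in> borel_measurable M"
    and bounded: "\<And>x. x \<in> space M \<Longrightarrow> \<bar>X x\<bar> \<le> B"
begin

abbreviation moment :: "nat \<Rightarrow> real" where
  "moment i \<equiv> expectation (\<lambda>x. X x ^ i)"

lemma integrable_bounded:
  fixes f :: "'a \<Rightarrow> real"
  assumes "f \<in> borel_measurable M" "\<And>x. x \<in> space M \<Longrightarrow> \<bar>f x\<bar> \<le> C"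
  shows "integrable M f"
  using assms by (intro integrable_const_bound[where B = C]) auto

lemma abs_mult_X_le: "x \<in> space M \<Longrightarrow> \<bar>t * X x\<bar> \<le> \<bar>t\<bar> * B"
  using bounded by (simp add: abs_mult mult_left_mono)

lemma abs_exp_series_term_le:
  "x \<in> space M \<Longrightarrow> \<bar>(t * X x) ^ i / fact i\<bar> \<le> (\<bar>t\<bar> * B) ^ i / fact i"
  using power_mono[OF abs_mult_X_le abs_ge_zero, of x t i]
  by (simp add: power_abs divide_right_mono)

lemma integrable_exp_series_term: "integrable M (\<lambda>x. (t * X x) ^ i / fact i)"
  using random_variable abs_exp_series_term_le
  by (intro integrable_bounded[where C = "(\<bar>t\<bar> * B) ^ i / fact i"]) simp_all

lemma summable_expectation_exp_series:
  "summable (\<lambda>i. expectation (\<lambda>x. norm ((t * X x) ^ i / fact i)))"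
proof -
  have "summable (\<lambda>i. (\<bar>t\<bar> * B) ^ i / fact i)"
    using summable_exp[of "\<bar>t\<bar> * B"] by (simp add: divide_inverse mult.commute)
  then show ?thesis
  proof (rule summable_comparison_test'[where N = 0])
    fix i
    have "expectation (\<lambda>x. norm ((t * X x) ^ i / fact i)) \<le> (\<bar>t\<bar> * B) ^ i / fact i"
      using integrable_norm[OF integrable_exp_series_term] abs_exp_series_term_le
      by (intro integral_le_const AE_I2) simp_all
    moreover have "0 \<le> expectation (\<lambda>x. norm ((t * X x) ^ i / fact i))"
      by (rule integral_nonneg_AE) simp
    ultimately show "norm (expectation (\<lambda>x. norm ((t * X x) ^ i / fact i))) \<le> (\<bar>t\<bar> * B) ^ i / fact i"
      by simp
  qed
qed

lemma mgf_sums: "(\<lambda>i. moment i / fact i * t ^ i) sums mgf M X t"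
proof -
  have "(\<lambda>i. expectation (\<lambda>x. (t * X x) ^ i / fact i)) sums (\<integral>x. (\<Sum>i. (t * X x) ^ i / fact i) \<partial>M)"
  proof (rule sums_integral[OF integrable_exp_series_term _ summable_expectation_exp_series])
    show "AE x in M. summable (\<lambda>i. norm ((t * X x) ^ i / fact i))"
    proof (rule AE_I2)
      fix x
      show "summable (\<lambda>i. norm ((t * X x) ^ i / fact i))"
        using summable_exp[of "\<bar>t * X x\<bar>"] by (simp add: abs_mult power_abs divide_inverse mult.commute)
    qed
  qed
  moreover have "expectation (\<lambda>x. (t * X x) ^ i / fact i) = moment i / fact i * t ^ i" for i
    by (simp add: power_mult_distrib)
  moreover have "(\<Sum>i. (t * X x) ^ i / fact i) = exp (t * X x)" for x
    using exp_converges[of "t * X x"] by (simp add: divide_inverse mult.commute sums_iff)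
  ultimately show ?thesis
    by (simp add: mgf_def)
qed

lemma mgf_pos: "0 < mgf M X t"
proof -
  have "exp (- (\<bar>t\<bar> * B)) \<le> mgf M X t"
    unfolding mgf_def
  proof (rule integral_ge_const)
    show "integrable M (\<lambda>x. exp (t * X x))"
      using random_variable abs_le_D1[OF abs_mult_X_le]
      by (intro integrable_bounded[where C = "exp (\<bar>t\<bar> * B)"]) simp_all
    show "AE x in M. exp (- (\<bar>t\<bar> * B)) \<le> exp (t * X x)"
    proof (rule AE_I2)
      fix x assume "x \<in> space M"
      then show "exp (- (\<bar>t\<bar> * B)) \<le> exp (t * X x)"
        using abs_mult_X_le[of x t] by simp
    qed
  qed
  then show ?thesis
    by (rule less_le_trans[rotated]) simp
qed

definition moment_fps :: "real fps" where
  "moment_fps = Abs_fps (\<lambda>i. moment i / fact i)"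

lemma fps_nth_moment_fps: "fps_nth moment_fps i = moment i / fact i"
  by (simp add: moment_fps_def)

lemma eval_moment_fps: "eval_fps moment_fps = mgf M X"
  using mgf_sums by (auto simp: eval_fps_def fps_nth_moment_fps sums_iff)

lemma fps_conv_radius_moment_fps: "fps_conv_radius moment_fps = \<infinity>"
  unfolding fps_conv_radius_def
proof (rule conv_radius_inftyI'[where c = 0])
  fix r :: real
  show "\<exists>z. norm z = r \<and> summable (\<lambda>i. fps_nth moment_fps i * z ^ i)" if "r > 0"
    using that mgf_sums[of r] by (intro exI[of _ r]) (auto simp: fps_nth_moment_fps sums_iff)
qed

lemma cumulant_Suc_eq:
  "cumulant M X (Suc m) = fact m * fps_nth (fps_deriv moment_fps / moment_fps) m"
proof -
  let ?h = "eval_fps moment_fps" and ?h' = "eval_fps (fps_deriv moment_fps)"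
  have deriv_ln: "deriv (\<lambda>t. ln (?h t)) t = ?h' t / ?h t" for t
  proof -
    have "(?h has_field_derivative ?h' t) (at t)"
      by (rule has_field_derivative_eval_fps) (simp add: fps_conv_radius_moment_fps)
    then have "((\<lambda>t. ln (?h t)) has_field_derivative (1 / ?h t) * ?h' t) (at t)"
      using mgf_pos by (intro DERIV_chain2[OF DERIV_ln_divide]) (simp_all add: eval_moment_fps)
    then show ?thesis
      by (simp add: DERIV_imp_deriv)
  qed
  have "(\<lambda>t. ?h' t / ?h t) has_fps_expansion fps_deriv moment_fps / moment_fps"
  proof (rule has_fps_expansion_divide')
    show "?h' has_fps_expansion fps_deriv moment_fps"
      using fps_conv_radius_deriv[of moment_fps]
      by (intro eval_fps_has_fps_expansion) (simp add: fps_conv_radius_moment_fps)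
    show "?h has_fps_expansion moment_fps"
      by (intro eval_fps_has_fps_expansion) (simp add: fps_conv_radius_moment_fps)
    show "fps_nth moment_fps 0 \<noteq> 0"
      by (simp add: fps_nth_moment_fps prob_space)
  qed
  then have "fps_nth (fps_deriv moment_fps / moment_fps) m = (deriv ^^ m) (\<lambda>t. ?h' t / ?h t) 0 / fact m"
    by (rule fps_nth_fps_expansion_real)
  moreover have "cumulant M X (Suc m) = (deriv ^^ m) (\<lambda>t. ?h' t / ?h t) 0"
    unfolding cumulant_def funpow_Suc_right o_def eval_moment_fps[symmetric]
    by (simp add: deriv_ln[abs_def])
  ultimately show ?thesis
    by simp
qed

lemma moment_cumulant_recursion:
  "moment (m + 1) = (\<Sum>i\<le>m. of_nat (m choose i) * cumulant M X (i + 1) * moment (m - i))"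
proof -
  let ?F = "moment_fps" and ?Q = "fps_deriv moment_fps / moment_fps"
  have "fps_nth ?F 0 = 1"
    by (simp add: fps_nth_moment_fps prob_space)
  then have "?Q * ?F = fps_deriv ?F"
    by (simp add: fps_divide_unit mult.assoc inverse_mult_eq_1)
  then have "fps_nth (fps_deriv ?F) m = fps_nth (?Q * ?F) m"
    by (simp only:)
  also have "\<dots> = (\<Sum>i\<le>m. fps_nth ?Q i * fps_nth ?F (m - i))"
    by (simp only: fps_mult_nth atLeast0AtMost)
  finally have "fps_nth (fps_deriv ?F) m = (\<Sum>i\<le>m. fps_nth ?Q i * fps_nth ?F (m - i))" .
  then have "moment (m + 1) = fact m * (\<Sum>i\<le>m. fps_nth ?Q i * fps_nth ?F (m - i))"
    by (simp add: fps_nth_moment_fps field_simps del: of_nat_Suc)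
  also have "\<dots> = (\<Sum>i\<le>m. of_nat (m choose i) * cumulant M X (i + 1) * moment (m - i))"
    unfolding sum_distrib_left
    by (intro sum.cong refl) (simp add: cumulant_Suc_eq fps_nth_moment_fps binomial_fact)
  finally show ?thesis .
qed

end

locale symmetric_bounded_random_variable = bounded_random_variable +
  assumes odd_moment_eq_0: "odd i \<Longrightarrow> moment i = 0"
begin

lemma cumulant_odd_eq_0: "odd m \<Longrightarrow> cumulant M X m = 0"
proof (induction m rule: less_induct)
  case (less m)
  then obtain k where m: "m = Suc k" and "even k"
    by (cases m) auto
  have "(\<Sum>i<k. of_nat (k choose i) * cumulant M X (i + 1) * moment (k - i)) = 0"
  proof (intro sum.neutral ballI)
    fix i assume "i \<in> {..<k}"
    then show "of_nat (k choose i) * cumulant M X (i + 1) * moment (k - i) = 0"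
      using less.IH[of "Suc i"] odd_moment_eq_0[of "k - i"] \<open>even k\<close> m by (cases "even i") auto
  qed
  then show ?case
    using moment_cumulant_recursion[of k] odd_moment_eq_0[of m] less.prems
    by (simp add: m lessThan_Suc_atMost[symmetric] prob_space)
qed

lemma odd_moments_and_cumulants:
  "moment 1 = 0" "moment 3 = 0" "moment 5 = 0"
  "cumulant M X 1 = 0" "cumulant M X 3 = 0" "cumulant M X 5 = 0"
  by (rule odd_moment_eq_0 cumulant_odd_eq_0; simp)+

lemma cumulant_2: "cumulant M X 2 = moment 2"
  using moment_cumulant_recursion[of 1] odd_moments_and_cumulants
  by (simp add: atMost_nat_numeral prob_space numeral_2_eq_2[symmetric])

lemma cumulant_4: "cumulant M X 4 = moment 4 - 3 * moment 2 ^ 2"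
proof -
  have "moment 4 = cumulant M X 4 + 3 * cumulant M X 2 * moment 2"
    using moment_cumulant_recursion[of 3] odd_moments_and_cumulants
    by (simp add: atMost_nat_numeral fact_numeral binomial_fact prob_space numeral_2_eq_2[symmetric])
  then show ?thesis
    by (simp add: cumulant_2 power2_eq_square)
qed

lemma cumulant_6: "cumulant M X 6 = moment 6 - 15 * moment 4 * moment 2 + 30 * moment 2 ^ 3"
proof -
  have "moment 6 = cumulant M X 6 + 10 * cumulant M X 4 * moment 2 + 5 * cumulant M X 2 * moment 4"
    using moment_cumulant_recursion[of 5] odd_moments_and_cumulants
    by (simp add: atMost_nat_numeral fact_numeral binomial_fact prob_space numeral_2_eq_2[symmetric])
  then show ?thesis
    by (simp add: cumulant_2 cumulant_4 power2_eq_square power3_eq_cube algebra_simps)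
qed

end


section \<open>Sums over tuples\<close>

text \<open>\<open>tuple_sum A w r f\<close> is the sum of \<open>f (w x\<^sub>1 + \<dots> + w x\<^sub>r)\<close> over all \<open>(x\<^sub>1, \<dots>, x\<^sub>r) \<in> A\<^sup>r\<close>.\<close>

fun tuple_sum :: "'i set \<Rightarrow> ('i \<Rightarrow> int) \<Rightarrow> nat \<Rightarrow> (int \<Rightarrow> 'a::comm_monoid_add) \<Rightarrow> 'a" where
  "tuple_sum A w 0 f = f 0"
| "tuple_sum A w (Suc r) f = (\<Sum>x\<in>A. tuple_sum A w r (\<lambda>s. f (w x + s)))"

lemma tuple_sum_zero [simp]: "tuple_sum A w r (\<lambda>s. 0) = 0"
  by (induction r) simp_all

lemma tuple_sum_add: "tuple_sum A w r (\<lambda>s. f s + g s) = tuple_sum A w r f + tuple_sum A w r g"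
  by (induction r arbitrary: f g) (simp_all add: sum.distrib)

lemma tuple_sum_sum: "tuple_sum A w r (\<lambda>s. \<Sum>y\<in>B. f y s) = (\<Sum>y\<in>B. tuple_sum A w r (f y))"
  by (induction r arbitrary: f) (simp_all add: sum.swap[of _ A])

lemma tuple_sum_mult_left:
  fixes f :: "int \<Rightarrow> 'a::semiring_0"
  shows "tuple_sum A w r (\<lambda>s. c * f s) = c * tuple_sum A w r f"
  by (induction r arbitrary: f) (simp_all add: sum_distrib_left)

lemma tuple_sum_singleton: "tuple_sum {x} w r f = f (int r * w x)"
  by (induction r arbitrary: f) (simp_all add: algebra_simps)

lemma tuple_sum_reindex:
  "inj_on g A \<Longrightarrow> tuple_sum (g ` A) w r f = tuple_sum A (w \<circ> g) r f"
  by (induction r arbitrary: f) (simp_all add: sum.reindex)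

lemma tuple_sum_affine:
  "tuple_sum A (\<lambda>x. c * w x + d) r f = tuple_sum A w r (\<lambda>s. f (c * s + int r * d))"
  by (induction r arbitrary: f) (simp_all add: algebra_simps)

lemma tuple_sum_eq_0:
  assumes "\<And>x. x \<in> A \<Longrightarrow> d \<le> w x" and "\<And>s. int r * d \<le> s \<Longrightarrow> f s = 0"
  shows "tuple_sum A w r f = 0"
  using assms(2)
proof (induction r arbitrary: f)
  case (Suc r)
  have "tuple_sum A w r (\<lambda>s. f (w x + s)) = 0" if "x \<in> A" for x
    using assms(1)[OF that] by (intro Suc.IH Suc.prems) (simp add: algebra_simps)
  then show ?case by simp
qed simp

lemma sum_choose_Suc:
  fixes F :: "nat \<Rightarrow> nat \<Rightarrow> 'a::comm_semiring_1"
  shows "(\<Sum>i\<le>Suc r. of_nat (Suc r choose i) * F i (Suc r - i))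
    = (\<Sum>i\<le>r. of_nat (r choose i) * (F (Suc i) (r - i) + F i (Suc r - i)))"
proof -
  have shift: "(\<Sum>i\<le>Suc r. of_nat (k choose i) * F i (Suc r - i))
      = F 0 (Suc r) + (\<Sum>i\<le>r. of_nat (k choose Suc i) * F (Suc i) (r - i))" for k
    by (simp only: sum.atMost_Suc_shift) simp
  have "(\<Sum>i\<le>Suc r. of_nat (Suc r choose i) * F i (Suc r - i))
      = (\<Sum>i\<le>r. of_nat (r choose i) * F (Suc i) (r - i))
        + (F 0 (Suc r) + (\<Sum>i\<le>r. of_nat (r choose Suc i) * F (Suc i) (r - i)))"
    unfolding shift by (simp add: distrib_right sum.distrib add_ac)
  also have "F 0 (Suc r) + (\<Sum>i\<le>r. of_nat (r choose Suc i) * F (Suc i) (r - i))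
      = (\<Sum>i\<le>r. of_nat (r choose i) * F i (Suc r - i))"
    using shift[of r] by (simp add: binomial_eq_0)
  finally show ?thesis
    by (simp add: distrib_left sum.distrib)
qed

lemma tuple_sum_Un:
  fixes f :: "int \<Rightarrow> 'a::comm_semiring_1"
  assumes "finite A" "finite B" "A \<inter> B = {}"
  shows "tuple_sum (A \<union> B) w r f
    = (\<Sum>i\<le>r. of_nat (r choose i) * tuple_sum A w i (\<lambda>s. tuple_sum B w (r - i) (\<lambda>t. f (s + t))))"
proof (induction r arbitrary: f)
  case (Suc r)
  define F where "F i l = tuple_sum A w i (\<lambda>s. tuple_sum B w l (\<lambda>t. f (s + t)))" for i l
  have A_part: "(\<Sum>x\<in>A. tuple_sum A w i (\<lambda>s. tuple_sum B w l (\<lambda>t. f (w x + (s + t))))) = F (Suc i) l"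
    for i l by (simp add: F_def add.assoc)
  have B_part: "(\<Sum>x\<in>B. tuple_sum A w i (\<lambda>s. tuple_sum B w l (\<lambda>t. f (w x + (s + t))))) = F i (Suc l)"
    for i l by (simp add: F_def tuple_sum_sum[symmetric] algebra_simps)
  have "tuple_sum (A \<union> B) w (Suc r) f = (\<Sum>x\<in>A \<union> B. \<Sum>i\<le>r. of_nat (r choose i) *
      tuple_sum A w i (\<lambda>s. tuple_sum B w (r - i) (\<lambda>t. f (w x + (s + t)))))"
    using Suc.IH by simp
  also have "\<dots> = (\<Sum>i\<le>r. of_nat (r choose i) * (F (Suc i) (r - i) + F i (Suc (r - i))))"
    using assms
    by (simp add: sum.union_disjoint sum.swap[of _ _ "{..r}"] sum_distrib_left A_part[symmetric]
        B_part[symmetric] sum.distrib distrib_left del: tuple_sum.simps)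
  also have "\<dots> = (\<Sum>i\<le>r. of_nat (r choose i) * (F (Suc i) (r - i) + F i (Suc r - i)))"
    by (intro sum.cong refl) (simp add: Suc_diff_le)
  also have "\<dots> = (\<Sum>i\<le>Suc r. of_nat (Suc r choose i) * F i (Suc r - i))"
    by (rule sum_choose_Suc[symmetric])
  finally show ?case by (simp only: F_def)
qed simp


lemma of_int_tuple_sum: "of_int (tuple_sum A w r f) = tuple_sum A w r (\<lambda>s. of_int (f s))"
  by (induction r arbitrary: f) simp_all

lemma integral_tuple_sum:
  assumes "\<And>s. integrable M (g s)"
  shows "integrable M (\<lambda>x. tuple_sum A w r (\<lambda>s. g s x))
    \<and> (\<integral>x. tuple_sum A w r (\<lambda>s. g s x) \<partial>M) = tuple_sum A w r (\<lambda>s. \<integral>x. g s x \<partial>M)"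
  using assms
proof (induction r arbitrary: g)
  case (Suc r)
  have IH: "integrable M (\<lambda>x. tuple_sum A w r (\<lambda>s. g (w y + s) x))
      \<and> (\<integral>x. tuple_sum A w r (\<lambda>s. g (w y + s) x) \<partial>M) = tuple_sum A w r (\<lambda>s. \<integral>x. g (w y + s) x \<partial>M)"
    for y using Suc.IH[of "\<lambda>s. g (w y + s)"] Suc.prems by simp
  have unfold: "(\<lambda>x. tuple_sum A w (Suc r) (\<lambda>s. g s x))
      = (\<lambda>x. \<Sum>y\<in>A. tuple_sum A w r (\<lambda>s. g (w y + s) x))"
    by simp
  have "integrable M (\<lambda>x. tuple_sum A w (Suc r) (\<lambda>s. g s x))"
    unfolding unfold by (rule Bochner_Integration.integrable_sum) (use IH in blast)
  moreover have "(\<integral>x. tuple_sum A w (Suc r) (\<lambda>s. g s x) \<partial>M)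
      = (\<Sum>y\<in>A. \<integral>x. tuple_sum A w r (\<lambda>s. g (w y + s) x) \<partial>M)"
    unfolding unfold by (rule Bochner_Integration.integral_sum) (use IH in blast)
  moreover have "\<dots> = tuple_sum A w (Suc r) (\<lambda>s. \<integral>x. g s x \<partial>M)"
    using IH by simp
  ultimately show ?case
    by simp
qed simp


section \<open>Counting sums of powers of two\<close>

lemma tuple_sum_pow2_Suc:
  fixes f :: "int \<Rightarrow> 'a::comm_semiring_1"
  shows "tuple_sum {1..Suc n} (\<lambda>k. 2 ^ k) r f
    = (\<Sum>i\<le>r. of_nat (r choose i) * tuple_sum {1..n} (\<lambda>k. 2 ^ k) (r - i) (\<lambda>s. f (2 * int i + 2 * s)))"
proof -
  have doubled:
    "tuple_sum (Suc ` {1..n}) (\<lambda>k. 2 ^ k) m g = tuple_sum {1..n} (\<lambda>k. 2 ^ k) m (\<lambda>s. g (2 * s))"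
    for m and g :: "int \<Rightarrow> 'a"
  proof -
    have "tuple_sum (Suc ` {1..n}) (\<lambda>k. 2 ^ k) m g = tuple_sum {1..n} (\<lambda>k. 2 * 2 ^ k + 0) m g"
      by (subst tuple_sum_reindex) (simp_all add: o_def)
    then show ?thesis
      by (simp only: tuple_sum_affine) simp
  qed
  have "{1..Suc n} = {1} \<union> Suc ` {1..n}"
    by auto
  then have "tuple_sum {1..Suc n} (\<lambda>k. 2 ^ k) r f = (\<Sum>i\<le>r. of_nat (r choose i) *
      tuple_sum {1} (\<lambda>k. 2 ^ k) i (\<lambda>s. tuple_sum (Suc ` {1..n}) (\<lambda>k. 2 ^ k) (r - i) (\<lambda>t. f (s + t))))"
    by (simp only:) (rule tuple_sum_Un, auto)
  then show ?thesis
    by (simp only: tuple_sum_singleton doubled) (simp add: mult.commute)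
qed

text \<open>A pattern \<open>(j, a, c)\<close> stands for the equation \<open>j + 2^k\<^sub>1 + \<dots> + 2^k\<^sub>a = 2^l\<^sub>1 + \<dots> + 2^l\<^sub>c\<close>;
  \<open>pow2_count n\<close> counts its solutions with all exponents in \<open>{1..n}\<close>.\<close>

type_synonym pattern = "int \<times> nat \<times> nat"

definition pow2_count :: "nat \<Rightarrow> pattern \<Rightarrow> int" where
  "pow2_count n = (\<lambda>(j, a, c). tuple_sum {1..n} (\<lambda>k. 2 ^ k) a (\<lambda>s.
     tuple_sum {1..n} (\<lambda>k. 2 ^ k) c (\<lambda>t. if j + s = t then 1 else 0)))"

text \<open>Choose which \<open>i\<close> of the \<open>a\<close> and which \<open>m\<close> of the \<open>c\<close> exponents equal 1,
  then halve the equation.\<close>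

definition count_step :: "(pattern \<Rightarrow> 'a::comm_ring_1) \<Rightarrow> pattern \<Rightarrow> 'a" where
  "count_step f = (\<lambda>(j, a, c). if even j then
     (\<Sum>i\<le>a. \<Sum>m\<le>c. of_nat (a choose i) * of_nat (c choose m) * f (j div 2 + int i - int m, a - i, c - m))
   else 0)"

lemma pow2_count_0: "pow2_count 0 s = (if s = (0, 0, 0) then 1 else 0)"
  by (cases s; rename_tac a c; case_tac a; case_tac c) (auto simp: pow2_count_def)

lemma pow2_count_Suc: "pow2_count (Suc n) = count_step (pow2_count n)"
proof (intro ext, clarify)
  fix j :: int and a c :: nat
  have eq: "(j + (2 * int i + 2 * s) = 2 * int m + 2 * t) \<longleftrightarrow> even j \<and> j div 2 + int i - int m + s = t"
    for i m :: nat and s t :: int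
    by presburger
  have "pow2_count (Suc n) (j, a, c) = (\<Sum>i\<le>a. \<Sum>m\<le>c. of_nat (a choose i) * of_nat (c choose m) *
      tuple_sum {1..n} (\<lambda>k. 2 ^ k) (a - i) (\<lambda>s. tuple_sum {1..n} (\<lambda>k. 2 ^ k) (c - m)
        (\<lambda>t. if j + (2 * int i + 2 * s) = 2 * int m + 2 * t then 1 else 0)))"
    by (simp only: pow2_count_def split_conv tuple_sum_pow2_Suc tuple_sum_sum tuple_sum_mult_left
        sum_distrib_left mult.assoc) (subst sum.swap, simp add: mult.left_commute)
  also have "\<dots> = count_step (pow2_count n) (j, a, c)"
    by (simp add: count_step_def pow2_count_def eq)
  finally show "pow2_count (Suc n) (j, a, c) = count_step (pow2_count n) (j, a, c)" .
qed

text \<open>Obstructions by parity, and because every power \<open>2^k\<close> with \<open>k \<ge> 1\<close> is at least 2.\<close>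

definition count_vanishes :: "pattern \<Rightarrow> bool" where
  "count_vanishes = (\<lambda>(j, a, c). odd j \<or> (c = 0 \<and> - 2 * int a < j) \<or> (a = 0 \<and> j < 2 * int c))"

lemma pow2_count_vanishes:
  assumes "count_vanishes s"
  shows "pow2_count n s = 0"
proof -
  obtain j a c where s: "s = (j, a, c)"
    by (cases s) auto
  have pow2_ge: "2 \<le> (2::int) ^ k" if "k \<in> {1..n}" for k
    using that by (simp add: self_le_power)
  consider "odd j" | "c = 0" "- 2 * int a < j" | "a = 0" "j < 2 * int c"
    using assms by (auto simp: count_vanishes_def s)
  then show ?thesis
  proof cases
    case 1
    then show ?thesis
      by (cases n) (auto simp: s pow2_count_0 pow2_count_Suc count_step_def)
  qed (auto simp: s pow2_count_def intro!: tuple_sum_eq_0[where d = 2] pow2_ge)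
qed

definition count_successors :: "pattern \<Rightarrow> pattern list" where
  "count_successors = (\<lambda>(j, a, c). if even j
     then [(j div 2 + int i - int m, a - i, c - m). i \<leftarrow> [0..<Suc a], m \<leftarrow> [0..<Suc c]] else [])"

lemma count_step_cong:
  assumes "\<And>t. t \<in> set (count_successors s) \<Longrightarrow> f t = g t"
  shows "count_step f s = count_step g s"
proof (cases s)
  case (fields j a c)
  have "f (j div 2 + int i - int m, a - i, c - m) = g (j div 2 + int i - int m, a - i, c - m)"
    if "even j" "i \<le> a" "m \<le> c" for i m
    using that by (intro assms) (force simp: fields count_successors_def)
  then show ?thesis
    by (simp add: fields count_step_def)
qed

lemma poly_count_step: "poly (count_step P s) x = count_step (\<lambda>t. poly (P t) x) s"
  by (cases s) (simp add: count_step_def poly_sum)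

definition count_closed :: "pattern list \<Rightarrow> bool" where
  "count_closed R \<longleftrightarrow> (\<forall>s\<in>set R. \<forall>t\<in>set (count_successors s). t \<in> set R \<or> count_vanishes t)"

lemma pow2_count_eq_poly:
  fixes P :: "pattern \<Rightarrow> int poly"
  assumes closed: "count_closed R"
    and P_vanishes: "\<And>t. count_vanishes t \<Longrightarrow> P t = 0"
    and base_values: "\<forall>s\<in>set R. pow2_count n\<^sub>0 s = poly (P s) (int n\<^sub>0)"
    and step_identity: "\<forall>s\<in>set R. count_step P s = P s \<circ>\<^sub>p [:1, 1:]"
    and "n\<^sub>0 \<le> n" "s \<in> set R"
  shows "pow2_count n s = poly (P s) (int n)"
  using \<open>n\<^sub>0 \<le> n\<close> \<open>s \<in> set R\<close>
proof (induction n arbitrary: s rule: dec_induct)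
  case base
  then show ?case using base_values by blast
next
  case (step n)
  have "pow2_count n t = poly (P t) (int n)" if "t \<in> set (count_successors s)" for t
    using closed step.prems step.IH that P_vanishes pow2_count_vanishes
    unfolding count_closed_def by fastforce
  then have "pow2_count (Suc n) s = count_step (\<lambda>t. poly (P t) (int n)) s"
    unfolding pow2_count_Suc by (rule count_step_cong)
  also have "\<dots> = poly (P s) (int (Suc n))"
    using step_identity step.prems by (simp add: poly_count_step[symmetric] poly_pcompose)
  finally show ?case .
qed

text \<open>Vanishing patterns are answered without a table lookup, which keeps evaluation fast.\<close>

definition lookup_counts :: "pattern list \<Rightarrow> int list \<Rightarrow> pattern \<Rightarrow> int" where
  "lookup_counts R vs s =
     (if count_vanishes s then 0 else case map_of (zip R vs) s of Some v \<Rightarrow> v | None \<Rightarrow> 0)"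

fun count_table :: "pattern list \<Rightarrow> nat \<Rightarrow> int list" where
  "count_table R 0 = map (\<lambda>s. if s = (0, 0, 0) then 1 else 0) R"
| "count_table R (Suc k) = map (count_step (lookup_counts R (count_table R k))) R"

lemma pow2_count_eq_count_table:
  assumes closed: "count_closed R" and "s \<in> set R \<or> count_vanishes s"
  shows "pow2_count k s = lookup_counts R (count_table R k) s"
  using assms(2)
proof (induction k arbitrary: s)
  case 0
  then show ?case
    by (auto simp: lookup_counts_def map_of_zip_map pow2_count_0 pow2_count_vanishes count_vanishes_def)
next
  case (Suc k)
  show ?case
  proof (cases "count_vanishes s")
    case False
    with Suc.prems have "s \<in> set R" by blast
    have "pow2_count (Suc k) s = count_step (lookup_counts R (count_table R k)) s"
      unfolding pow2_count_Suc
      using closed \<open>s \<in> set R\<close> by (intro count_step_cong Suc.IH) (auto simp: count_closed_def)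
    with False \<open>s \<in> set R\<close> show ?thesis
      by (simp add: lookup_counts_def map_of_zip_map)
  qed (simp add: lookup_counts_def pow2_count_vanishes)
qed

text \<open>Interpolated from tabulated values of \<open>pow2_count\<close>; valid from \<open>n = 7\<close> on.\<close>

definition closed_form_table :: "(pattern \<times> int poly) list" where
  "closed_form_table =
  [((-6, 1, 0), 0),
   ((-6, 1, 1), [:1:]),
   ((-4, 1, 0), [:1:]),
   ((-4, 1, 1), [:1:]),
   ((-4, 1, 2), [:3:]),
   ((-4, 1, 3), [:10:]),
   ((-4, 1, 5), [:295:]),
   ((-4, 2, 0), [:1:]),
   ((-4, 2, 1), [:-1, 2:]),
   ((-2, 1, 0), [:1:]),
   ((-2, 1, 1), [:1:]),
   ((-2, 1, 2), [:2:]),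
   ((-2, 1, 3), [:7:]),
   ((-2, 1, 4), [:32:]),
   ((-2, 1, 5), [:190:]),
   ((-2, 2, 1), [:-1, 2:]),
   ((-2, 2, 2), [:-8, 6:]),
   ((-2, 2, 3), [:-53, 24:]),
   ((-2, 2, 4), [:-396, 130:]),
   ((-2, 3, 1), [:-5, 3:]),
   ((0, 0, 0), [:1:]),
   ((0, 1, 1), [:0, 1:]),
   ((0, 1, 2), [:-1, 1:]),
   ((0, 1, 3), [:-6, 3:]),
   ((0, 1, 4), [:-38, 13:]),
   ((0, 2, 1), [:-1, 1:]),
   ((0, 2, 2), [:0, -1, 2:]),
   ((0, 3, 1), [:-6, 3:]),
   ((0, 3, 3), [:42, -35, 0, 6:]),
   ((0, 4, 1), [:-38, 13:]),
   ((2, 0, 1), [:1:]),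
   ((2, 1, 1), [:1:]),
   ((2, 1, 2), [:-1, 2:]),
   ((2, 1, 3), [:-5, 3:]),
   ((2, 2, 1), [:2:]),
   ((2, 2, 2), [:-8, 6:]),
   ((2, 3, 1), [:7:]),
   ((2, 3, 2), [:-53, 24:]),
   ((2, 4, 1), [:32:]),
   ((2, 4, 2), [:-396, 130:]),
   ((2, 5, 1), [:190:]),
   ((4, 0, 1), [:1:]),
   ((4, 0, 2), [:1:]),
   ((4, 1, 1), [:1:]),
   ((4, 1, 2), [:-1, 2:]),
   ((4, 2, 1), [:3:]),
   ((4, 3, 1), [:10:]),
   ((4, 5, 1), [:295:]),
   ((6, 0, 1), 0),
   ((6, 1, 1), [:1:])]"

definition closed_form :: "pattern \<Rightarrow> int poly" where
  "closed_form s =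
     (if count_vanishes s then 0 else case map_of closed_form_table s of Some p \<Rightarrow> p | None \<Rightarrow> 0)"

definition closed_form_certificate :: "nat \<Rightarrow> pattern list \<Rightarrow> bool" where
  "closed_form_certificate n\<^sub>0 R \<longleftrightarrow> count_closed R
     \<and> (\<forall>s\<in>set R. lookup_counts R (count_table R n\<^sub>0) s = poly (closed_form s) (int n\<^sub>0))
     \<and> (\<forall>s\<in>set R. count_step closed_form s = closed_form s \<circ>\<^sub>p [:1, 1:])"

lemma pow2_count_eq_closed_form:
  assumes "closed_form_certificate n\<^sub>0 R" "n\<^sub>0 \<le> n" "s \<in> set R"
  shows "pow2_count n s = poly (closed_form s) (int n)"
proof (rule pow2_count_eq_poly[where R = R and n\<^sub>0 = n\<^sub>0])
  show "\<forall>s\<in>set R. pow2_count n\<^sub>0 s = poly (closed_form s) (int n\<^sub>0)"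
    using assms(1) pow2_count_eq_count_table[of R] by (simp add: closed_form_certificate_def)
  show "closed_form t = 0" if "count_vanishes t" for t
    using that by (simp add: closed_form_def)
qed (use assms in \<open>simp_all add: closed_form_certificate_def\<close>)

lemma pow2_count_second_moment: "pow2_count n (0, 1, 1) = int n"
proof -
  have "closed_form_certificate 0 [(0, 0, 0), (0, 1, 1)]"
    by code_simp
  from pow2_count_eq_closed_form[OF this, of n "(0, 1, 1)"] show ?thesis
    by (simp add: closed_form_def closed_form_table_def count_vanishes_def)
qed

lemma pow2_count_fourth_moment:
  assumes "4 \<le> n"
  shows "pow2_count n (-2, 1, 3) = 7" "pow2_count n (0, 2, 2) = 2 * int n ^ 2 - int n"
    "pow2_count n (2, 3, 1) = 7"
proof -
  have "closed_form_certificate 4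
    [(-4, 1, 0), (-2, 1, 0), (-2, 1, 1), (-2, 1, 2), (-2, 1, 3), (0, 0, 0), (0, 1, 1), (0, 2, 2),
     (2, 0, 1), (2, 1, 1), (2, 2, 1), (2, 3, 1), (4, 0, 1)]"
    by code_simp
  from pow2_count_eq_closed_form[OF this assms] show
    "pow2_count n (-2, 1, 3) = 7" "pow2_count n (0, 2, 2) = 2 * int n ^ 2 - int n"
    "pow2_count n (2, 3, 1) = 7"
    by (simp_all add: closed_form_def closed_form_table_def count_vanishes_def power2_eq_square
        algebra_simps)
qed

lemma pow2_count_sixth_moment:
  assumes "7 \<le> n"
  shows "pow2_count n (-4, 1, 5) = 295" "pow2_count n (-2, 2, 4) = 130 * int n - 396"
    "pow2_count n (0, 3, 3) = 6 * int n ^ 3 - 35 * int n + 42"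
    "pow2_count n (2, 4, 2) = 130 * int n - 396" "pow2_count n (4, 5, 1) = 295"
proof -
  have "closed_form_certificate 7 (map fst closed_form_table)"
    by code_simp
  from pow2_count_eq_closed_form[OF this assms] show
    "pow2_count n (-4, 1, 5) = 295" "pow2_count n (-2, 2, 4) = 130 * int n - 396"
    "pow2_count n (0, 3, 3) = 6 * int n ^ 3 - 35 * int n + 42"
    "pow2_count n (2, 4, 2) = 130 * int n - 396" "pow2_count n (4, 5, 1) = 295"
    by (simp_all add: closed_form_def closed_form_table_def count_vanishes_def power3_eq_cube
        algebra_simps)
qed


section \<open>Moments of \<open>S n\<close>\<close>

lemma prob_space_unit_interval: "prob_space (lebesgue_on {0..1::real})"
  by (rule prob_space_restrict_space) auto

lemma continuous_on_S [continuous_intros]: "continuous_on A (S n)"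
  unfolding S_def by (intro continuous_intros)

lemma abs_S_le: "\<bar>S n x\<bar> \<le> real n"
proof -
  have "\<bar>S n x\<bar> \<le> (\<Sum>k=1..n. \<bar>cos (2 * pi * real (a_seq k) * x)\<bar>)"
    unfolding S_def by (rule sum_abs)
  also have "\<dots> \<le> (\<Sum>k=1..n. 1)"
    by (intro sum_mono) simp
  finally show ?thesis
    by simp
qed

lemma S_eq: "S n x = (\<Sum>k=1..n. cos (2 * pi * of_int (2 ^ k + 1) * x))"
  by (simp add: S_def a_seq_def add.commute)

lemma cos_add_cos_diff:
  "cos (2 * pi * of_int (a + s) * x) + cos (2 * pi * of_int (- a + s) * x)
    = 2 * cos (2 * pi * of_int a * x) * cos (2 * pi * of_int s * x)"
proof -
  have "cos (2 * pi * of_int (a + s) * x) = cos (2 * pi * of_int s * x + 2 * pi * of_int a * x)"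
    "cos (2 * pi * of_int (- a + s) * x) = cos (2 * pi * of_int s * x - 2 * pi * of_int a * x)"
    by (simp_all add: algebra_simps)
  then show ?thesis
    by (simp add: cos_add cos_diff)
qed

lemma S_power:
  "S n x ^ r = tuple_sum ({1..n} \<times> {1, -1}) (\<lambda>(k, e). e * (2 ^ k + 1)) r
     (\<lambda>s. cos (2 * pi * of_int s * x)) / 2 ^ r"
proof (induction r)
  case (Suc r)
  let ?A = "{1..n} \<times> {1, -1::int}" and ?w = "\<lambda>(k, e). e * (2 ^ k + 1) :: int"
  let ?c = "\<lambda>s::int. cos (2 * pi * of_int s * x)"
  have "tuple_sum ?A ?w (Suc r) ?c
      = (\<Sum>k=1..n. tuple_sum ?A ?w r (\<lambda>s. ?c ((2 ^ k + 1) + s) + ?c (- (2 ^ k + 1) + s)))"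
    by (simp add: sum.cartesian_product' tuple_sum_add)
  also have "\<dots> = (\<Sum>k=1..n. tuple_sum ?A ?w r (\<lambda>s. 2 * ?c (2 ^ k + 1) * ?c s))"
    by (simp only: cos_add_cos_diff)
  also have "\<dots> = 2 * S n x * tuple_sum ?A ?w r ?c"
    by (simp add: tuple_sum_mult_left S_eq sum_distrib_left sum_distrib_right mult.assoc)
  finally show ?case
    using Suc by (simp add: field_simps)
qed simp

lemma integral_cos_int:
  "(\<integral>x. cos (2 * pi * of_int m * x) \<partial>lebesgue_on {0..1}) = (if m = 0 then 1 else 0)"
proof -
  have "(\<integral>x. cos (2 * pi * of_int m * x) \<partial>lebesgue_on {0..1})
      = integral {0..1} (\<lambda>x. cos (2 * pi * of_int m * x))"
    by (intro lebesgue_integral_eq_integral continuous_imp_integrable_real continuous_intros) auto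
  also have "\<dots> = (if m = 0 then 1 else 0)"
  proof (cases "m = 0")
    case False
    have "((\<lambda>x. sin (2 * pi * of_int m * x) / (2 * pi * of_int m)) has_vector_derivative
        cos (2 * pi * of_int m * x)) (at x within {0..1})" for x
      unfolding has_real_derivative_iff_has_vector_derivative[symmetric]
      using False by (auto intro!: derivative_eq_intros simp: field_simps)
    then have "((\<lambda>x. cos (2 * pi * of_int m * x)) has_integral
        (sin (2 * pi * of_int m * 1) / (2 * pi * of_int m)
          - sin (2 * pi * of_int m * 0) / (2 * pi * of_int m))) {0..1}"
      by (intro fundamental_theorem_of_calculus) auto
    then show ?thesis
      using False by (simp add: integral_unique)
  qed simp
  finally show ?thesis .
qed

lemma of_int_pow2_count:
  "of_int (pow2_count n (j, a, c)) = tuple_sum {1..n} (\<lambda>k. 2 ^ k) a (\<lambda>s.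
     tuple_sum {1..n} (\<lambda>k. 2 ^ k) c (\<lambda>t. if j + s = t then 1 else (0::real)))"
proof -
  have indicator: "(\<lambda>t. of_int (if j + s = t then 1 else 0)) = (\<lambda>t. if j + s = t then 1 else (0::real))"
    for s by auto
  show ?thesis
    by (simp only: pow2_count_def split_conv of_int_tuple_sum indicator)
qed

lemma tuple_sum_signed_copy:
  "tuple_sum ((\<lambda>k. (k, e)) ` A) (\<lambda>(k, e). e * (v k + 1)) r g
    = tuple_sum A v r (\<lambda>s. g (e * s + int r * e))"
proof -
  have "tuple_sum ((\<lambda>k. (k, e)) ` A) (\<lambda>(k, e). e * (v k + 1)) r g = tuple_sum A (\<lambda>k. e * v k + e) r g"
    by (subst tuple_sum_reindex) (auto simp: inj_on_def o_def algebra_simps)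
  then show ?thesis
    by (simp only: tuple_sum_affine)
qed

lemma tuple_sum_signed_pow2:
  "tuple_sum ({1..n} \<times> {1, -1}) (\<lambda>(k, e). e * (2 ^ k + 1)) r (\<lambda>s. if s = 0 then 1 else (0::real))
    = (\<Sum>a\<le>r. of_nat (r choose a) * of_int (pow2_count n (2 * int a - int r, a, r - a)))"
proof -
  let ?A = "{1..n}" and ?w = "\<lambda>(k, e). e * (2 ^ k + 1) :: int"
  have "?A \<times> {1, -1::int} = (\<lambda>k. (k, 1)) ` ?A \<union> (\<lambda>k. (k, -1)) ` ?A"
    by auto
  then have "tuple_sum (?A \<times> {1, -1}) ?w r (\<lambda>s. if s = 0 then 1 else (0::real))
      = (\<Sum>a\<le>r. of_nat (r choose a) * tuple_sum ((\<lambda>k. (k, 1)) ` ?A) ?w a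
          (\<lambda>s. tuple_sum ((\<lambda>k. (k, -1)) ` ?A) ?w (r - a) (\<lambda>t. if s + t = 0 then 1 else 0)))"
    by (simp only:) (rule tuple_sum_Un, auto)
  also have "\<dots> = (\<Sum>a\<le>r. of_nat (r choose a) * tuple_sum ?A (\<lambda>k. 2 ^ k) a (\<lambda>s.
      tuple_sum ?A (\<lambda>k. 2 ^ k) (r - a) (\<lambda>t. if s + int a - t - int (r - a) = 0 then 1 else 0)))"
    by (simp only: tuple_sum_signed_copy) (simp add: algebra_simps)
  also have "\<dots> = (\<Sum>a\<le>r. of_nat (r choose a) * of_int (pow2_count n (2 * int a - int r, a, r - a)))"
  proof (intro sum.cong refl arg_cong2[where f = "(*)"])
    fix a assume "a \<in> {..r}"
    then have cond: "(s + int a - t - int (r - a) = 0) = (2 * int a - int r + s = t)" for s t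
      by auto
    show "tuple_sum ?A (\<lambda>k. 2 ^ k) a (\<lambda>s. tuple_sum ?A (\<lambda>k. 2 ^ k) (r - a)
          (\<lambda>t. if s + int a - t - int (r - a) = 0 then 1 else (0::real)))
        = of_int (pow2_count n (2 * int a - int r, a, r - a))"
      unfolding of_int_pow2_count by (simp only: cond)
  qed
  finally show ?thesis .
qed

lemma moment_S:
  "(\<integral>x. S n x ^ r \<partial>lebesgue_on {0..1})
    = (\<Sum>a\<le>r. of_nat (r choose a) * of_int (pow2_count n (2 * int a - int r, a, r - a))) / 2 ^ r"
proof -
  let ?A = "{1..n} \<times> {1, -1::int}" and ?w = "\<lambda>(k, e). e * (2 ^ k + 1) :: int"
  have cos_integrable: "integrable (lebesgue_on {0..1}) (\<lambda>x. cos (2 * pi * of_int s * x))" for s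
    by (intro continuous_imp_integrable_real continuous_intros)
  have "(\<integral>x. S n x ^ r \<partial>lebesgue_on {0..1})
      = (\<integral>x. tuple_sum ?A ?w r (\<lambda>s. cos (2 * pi * of_int s * x)) \<partial>lebesgue_on {0..1}) / 2 ^ r"
    by (simp only: S_power integral_divide_zero)
  also have "\<dots> = tuple_sum ?A ?w r (\<lambda>s. \<integral>x. cos (2 * pi * of_int s * x) \<partial>lebesgue_on {0..1}) / 2 ^ r"
    by (simp only: integral_tuple_sum[OF cos_integrable, THEN conjunct2])
  also have "\<dots> = tuple_sum ?A ?w r (\<lambda>s. if s = 0 then 1 else 0) / 2 ^ r"
    by (simp only: integral_cos_int)
  finally show ?thesis
    by (simp only: tuple_sum_signed_pow2)
qed

lemma moment_S_odd:
  assumes "odd r"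
  shows "(\<integral>x. S n x ^ r \<partial>lebesgue_on {0..1}) = 0"
proof -
  have "pow2_count n (2 * int a - int r, a, r - a) = 0" for a
    using assms by (intro pow2_count_vanishes) (simp add: count_vanishes_def)
  then show ?thesis
    by (simp add: moment_S)
qed

interpretation S: symmetric_bounded_random_variable "lebesgue_on {0..1}" "S n" "real n" for n
proof -
  have "bounded_random_variable (lebesgue_on {0..1}) (S n) (real n)"
    unfolding bounded_random_variable_def bounded_random_variable_axioms_def
    using prob_space_unit_interval abs_S_le
    by (simp add: continuous_imp_measurable_on_sets_lebesgue continuous_on_S)
  then show "symmetric_bounded_random_variable (lebesgue_on {0..1}) (S n) (real n)"
    unfolding symmetric_bounded_random_variable_def symmetric_bounded_random_variable_axioms_def
    using moment_S_odd by simp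
qed

lemma moment_S_2: "(\<integral>x. S n x ^ 2 \<partial>lebesgue_on {0..1}) = real n / 2"
proof -
  have "pow2_count n (-2, 0, 2) = 0" "pow2_count n (2, 2, 0) = 0"
    by (simp_all add: pow2_count_vanishes count_vanishes_def)
  then show ?thesis
    using pow2_count_second_moment[of n] by (simp add: moment_S atMost_nat_numeral)
qed

lemma moment_S_4:
  assumes "4 \<le> n"
  shows "(\<integral>x. S n x ^ 4 \<partial>lebesgue_on {0..1}) = (6 * real n ^ 2 - 3 * real n + 28) / 8"
proof -
  have "pow2_count n (-4, 0, 4) = 0" "pow2_count n (4, 4, 0) = 0"
    by (simp_all add: pow2_count_vanishes count_vanishes_def)
  moreover have "(\<integral>x. S n x ^ 4 \<partial>lebesgue_on {0..1}) = (of_int (pow2_count n (-4, 0, 4))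
      + 4 * of_int (pow2_count n (-2, 1, 3)) + 6 * of_int (pow2_count n (0, 2, 2))
      + 4 * of_int (pow2_count n (2, 3, 1)) + of_int (pow2_count n (4, 4, 0))) / 16"
    by (simp add: moment_S atMost_nat_numeral binomial_fact fact_numeral)
  ultimately show ?thesis
    by (simp only: pow2_count_fourth_moment[OF assms]) (simp add: field_simps power2_eq_square)
qed

lemma moment_S_6:
  assumes "7 \<le> n"
  shows "(\<integral>x. S n x ^ 6 \<partial>lebesgue_on {0..1}) = (30 * real n ^ 3 + 800 * real n - 1875) / 16"
proof -
  have "pow2_count n (-6, 0, 6) = 0" "pow2_count n (6, 6, 0) = 0"
    by (simp_all add: pow2_count_vanishes count_vanishes_def)
  moreover have "(\<integral>x. S n x ^ 6 \<partial>lebesgue_on {0..1}) = (of_int (pow2_count n (-6, 0, 6))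
      + 6 * of_int (pow2_count n (-4, 1, 5)) + 15 * of_int (pow2_count n (-2, 2, 4))
      + 20 * of_int (pow2_count n (0, 3, 3)) + 15 * of_int (pow2_count n (2, 4, 2))
      + 6 * of_int (pow2_count n (4, 5, 1)) + of_int (pow2_count n (6, 6, 0))) / 64"
    by (simp add: moment_S atMost_nat_numeral binomial_fact fact_numeral)
  ultimately show ?thesis
    by (simp only: pow2_count_sixth_moment[OF assms]) (simp add: field_simps power3_eq_cube)
qed

theorem theoremB:
  shows "(\<forall>n m. n \<ge> 1 \<longrightarrow> odd m \<longrightarrow> cumulant (lebesgue_on {0..1}) (S n) m = 0)
    \<and> (\<forall>n. n \<ge> 1 \<longrightarrow> cumulant (lebesgue_on {0..1}) (S n) 2 = real n / 2)
    \<and> (\<forall>n. n \<ge> 4 \<longrightarrow> cumulant (lebesgue_on {0..1}) (S n) 4 = (- 3 * real n + 28) / 8)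
    \<and> (\<forall>n. n \<ge> 7 \<longrightarrow> cumulant (lebesgue_on {0..1}) (S n) 6
          = (45 * (real n)^2 + 380 * real n - 1875) / 16)"
proof (intro conjI allI impI)
  fix n m :: nat
  assume "odd m"
  then show "cumulant (lebesgue_on {0..1}) (S n) m = 0"
    by (rule S.cumulant_odd_eq_0)
next
  fix n :: nat
  show "cumulant (lebesgue_on {0..1}) (S n) 2 = real n / 2"
    by (simp only: S.cumulant_2 moment_S_2)
next
  fix n :: nat
  assume "4 \<le> n"
  then show "cumulant (lebesgue_on {0..1}) (S n) 4 = (- 3 * real n + 28) / 8"
    by (simp only: S.cumulant_4 moment_S_2 moment_S_4) (simp add: field_simps power2_eq_square)
next
  fix n :: nat
  assume "7 \<le> n"
  then show "cumulant (lebesgue_on {0..1}) (S n) 6 = (45 * (real n)^2 + 380 * real n - 1875) / 16"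
    by (simp only: S.cumulant_6 moment_S_2 moment_S_4 moment_S_6)
      (simp add: field_simps power2_eq_square power3_eq_cube)
qed

end
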